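(* Let $n\ge 1$. The map $\phi:\mathcal D_{2n+1,n+1}\to DD_{2n+2}$ defined, for $a_1a_2\cdots a_{2n}(2n+1)\in\mathcal D_{2n+1,n+1}$ in one-line notation, by $$\phi(a_1a_2\dots a_{2n}(2n+1))=a_1',\,1,\,a_3',\,a_2',\,a_5',\,a_4',\,\dots,\,a_{2n-1}',\,a_{2n-2}',\,2n+2,\,a_{2n}',$$ where $a_j'=a_j+1$, is a bijection.
   Context: $\mathcal D_{2n+1,n+1}$ (the D-permutations) is the set of $\sigma\in\mathfrak S_{2n+1}$ with $\sigma(i)\le i$ for every even $i$ and $\sigma(i)\ge i$ for every odd $i$; necessarily $\sigma(2n+1)=2n+1$. $DD_{2n+2}$ (the Dumont derangements) is the set of $\sigma\in\mathfrak S_{2n+2}$ with $\sigma(2i)<2i$ and $\sigma(2i-1)>2i-1$ for all $1\le i\le n+1$. In the displayed word, the entry in position $2i-1$ is $a_{2i-1}'$ for $1\le i\le n$ and $2n+2$ for $i=n+1$; the entry in position $2$ is $1$, and the entry in position $2i$ is $a_{2i-2}'$ for $2\le i\le n+1$. *)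

theory Defs
  imports "HOL-Combinatorics.Permutations"
begin

text \<open>A permutation of \<open>{1..m}\<close> is a function satisfying \<open>permutes {1..m}\<close>;
  it is therefore the identity on all other natural numbers, and its one-line notation is
  \<open>\<sigma> 1, \<sigma> 2, \<dots>, \<sigma> m\<close>.\<close>

text \<open>Both sets below are indexed by \<open>n\<close>: they consist of permutations of \<open>{1..2n+1}\<close>
  and of \<open>{1..2n+2}\<close>, respectively. In the first one the equation \<open>\<sigma> (2n+1) = 2n+1\<close> is not imposed:
  it follows from the condition at the odd point \<open>2n+1\<close>.\<close>

definition D_permutations :: "nat \<Rightarrow> (nat \<Rightarrow> nat) set" where
  "D_permutations n = {\<sigma>. \<sigma> permutes {1..2*n+1} \<and>
     (\<forall>i\<in>{1..2*n+1}. (even i \<longrightarrow> \<sigma> i \<le> i) \<and> (odd i \<longrightarrow> \<sigma> i \<ge> i))}"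

definition Dumont_derangements :: "nat \<Rightarrow> (nat \<Rightarrow> nat) set" where
  "Dumont_derangements n = {\<sigma>. \<sigma> permutes {1..2*n+2} \<and>
     (\<forall>i\<in>{1..n+1}. \<sigma> (2*i) < 2*i \<and> \<sigma> (2*i-1) > 2*i-1)}"

text \<open>\<open>phi n a\<close> has the one-line notation
  \<open>a(1)+1, 1, a(3)+1, a(2)+1, \<dots>, a(2n-1)+1, a(2n-2)+1, 2n+2, a(2n)+1\<close>
  and is extended by the identity outside \<open>{1..2n+2}\<close>.\<close>

definition phi :: "nat \<Rightarrow> (nat \<Rightarrow> nat) \<Rightarrow> nat \<Rightarrow> nat" where
  "phi n a j =
     (if j \<notin> {1..2*n+2} then j
      else if j = 2*n+1 then 2*n+2
      else if j = 2 then 1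
      else if odd j then a j + 1
      else a (j-2) + 1)"

end

theory Submission
  imports Defs
begin

text \<open>A D-permutation \<open>a\<close> fixes \<open>2n+1\<close>, and its extension by the identity fixes \<open>0\<close>; hence
  \<open>phi n a\<close> is uniformly \<open>Suc \<circ> a \<circ> s\<close> on \<open>{1..2n+2}\<close>, where the bijection \<open>s\<close> from \<open>{1..2n+2}\<close>
  to \<open>{0..2n+1}\<close> fixes odd numbers and subtracts 2 from even ones. So \<open>phi\<close> is inverted by
  conjugating back with \<open>Suc\<close> and the inverse \<open>t\<close> of \<open>s\<close>, and the inequalities defining the two
  classes correspond.\<close>

definition shift_down :: "nat \<Rightarrow> nat" where
  "shift_down j = (if odd j then j else j - 2)"

definition shift_up :: "nat \<Rightarrow> nat" where
  "shift_up k = (if odd k then k else k + 2)"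

lemma shift_down_shift_up [simp]: "shift_down (shift_up k) = k"
  by (simp add: shift_down_def shift_up_def)

text \<open>Truncated subtraction sends both 0 and 2 to 0, so 0 has to be excluded.\<close>

lemma shift_up_shift_down [simp]:
  assumes "j \<ge> 1"
  shows "shift_up (shift_down j) = j"
  using assms by (auto simp: shift_down_def shift_up_def elim!: evenE)

lemma shift_down_in_iff:
  assumes "j \<ge> 1"
  shows "shift_down j \<le> 2*n+1 \<longleftrightarrow> j \<le> 2*n+2"
  using assms unfolding shift_down_def by presburger

lemma shift_up_in_iff: "shift_up k \<in> {1..2*n+2} \<longleftrightarrow> k \<le> 2*n+1"
  by (auto simp: shift_up_def elim!: evenE oddE)

lemma bij_betw_shift_down: "bij_betw shift_down {1..2*n+2} {0..2*n+1}"
proof (rule bij_betw_byWitness[where f' = shift_up])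
  show "shift_down ` {1..2*n+2} \<subseteq> {0..2*n+1}"
    using shift_down_in_iff by auto
  show "shift_up ` {0..2*n+1} \<subseteq> {1..2*n+2}"
    using shift_up_in_iff by fastforce
qed auto

lemma bij_betw_shift_up: "bij_betw shift_up {0..2*n+1} {1..2*n+2}"
proof (rule bij_betw_byWitness[where f' = shift_down])
  show "shift_down ` {1..2*n+2} \<subseteq> {0..2*n+1}"
    using shift_down_in_iff by auto
  show "shift_up ` {0..2*n+1} \<subseteq> {1..2*n+2}"
    using shift_up_in_iff by fastforce
qed auto

lemma D_permutations_permutes: "a \<in> D_permutations n \<Longrightarrow> a permutes {1..2*n+1}"
  by (simp add: D_permutations_def)

lemma D_permutations_0: "a \<in> D_permutations n \<Longrightarrow> a 0 = 0"
  using permutes_not_in[OF D_permutations_permutes] by force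

lemma D_permutations_le: "a \<in> D_permutations n \<Longrightarrow> k \<le> 2*n+1 \<Longrightarrow> a k \<le> 2*n+1"
  using permutes_in_image[OF D_permutations_permutes, of a n k] D_permutations_0[of a n]
  by (cases "k = 0") auto

lemma D_permutations_even: "a \<in> D_permutations n \<Longrightarrow> i \<in> {1..2*n+1} \<Longrightarrow> even i \<Longrightarrow> a i \<le> i"
  unfolding D_permutations_def by blast

lemma D_permutations_odd: "a \<in> D_permutations n \<Longrightarrow> i \<in> {1..2*n+1} \<Longrightarrow> odd i \<Longrightarrow> a i \<ge> i"
  unfolding D_permutations_def by blast

lemma D_permutations_last:
  assumes "a \<in> D_permutations n"
  shows "a (2*n+1) = 2*n+1"
proof (rule antisym)
  show "a (2*n+1) \<le> 2*n+1"
    using D_permutations_le[OF assms] by blast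
  show "2*n+1 \<le> a (2*n+1)"
    using D_permutations_odd[OF assms] by simp
qed

lemma phi_eq:
  assumes "a \<in> D_permutations n"
  shows "phi n a j = (if j \<in> {1..2*n+2} then Suc (a (shift_down j)) else j)"
  \<comment> \<open>The special entries 1 at position 2 and 2n+2 at position 2n+1 are
    \<open>Suc (a 0)\<close> and \<open>Suc (a (2*n+1))\<close>.\<close>
  using D_permutations_0[OF assms] D_permutations_last[OF assms]
  by (auto simp: phi_def shift_down_def)

text \<open>The guard includes 0, whose value is read off from position 2. Beyond 2n+1 the identity
  is needed for equality with a D-permutation as a function on all naturals.\<close>

definition phi_inv :: "nat \<Rightarrow> (nat \<Rightarrow> nat) \<Rightarrow> nat \<Rightarrow> nat" where
  "phi_inv n b k = (if k \<le> 2*n+1 then b (shift_up k) - 1 else k)"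

lemma Dumont_derangements_permutes: "b \<in> Dumont_derangements n \<Longrightarrow> b permutes {1..2*n+2}"
  by (simp add: Dumont_derangements_def)

lemma Dumont_derangements_even:
  assumes "b \<in> Dumont_derangements n" "even j" "j \<in> {1..2*n+2}"
  shows "b j < j"
  using assms by (auto simp: Dumont_derangements_def elim!: evenE)

lemma Dumont_derangements_odd:
  assumes "b \<in> Dumont_derangements n" "odd j" "j \<in> {1..2*n+2}"
  shows "b j > j"
proof -
  obtain i where i: "j = 2*i+1"
    using assms(2) by (rule oddE)
  have "\<forall>i\<in>{1..n+1}. 2*i-1 < b (2*i-1)"
    using assms(1) by (simp add: Dumont_derangements_def)
  from this[rule_format, of "Suc i"] show ?thesis
    using i assms(3) by simp
qed

lemma phi_in_Dumont_derangements:
  assumes "a \<in> D_permutations n"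
  shows "phi n a \<in> Dumont_derangements n"
proof -
  \<comment> \<open>The fixed point 0 is adjoined because \<open>shift_down\<close> sends 2 to
    0.\<close>
  have "a permutes {0..2*n+1}"
    using D_permutations_permutes[OF assms] by (rule permutes_subset) auto
  then have "bij_betw a {0..2*n+1} {0..2*n+1}"
    by (rule permutes_imp_bij)
  moreover have "bij_betw Suc {0..2*n+1} {1..2*n+2}"
    by (simp add: bij_betw_def)
  ultimately have "bij_betw (Suc \<circ> (a \<circ> shift_down)) {1..2*n+2} {1..2*n+2}"
    by (meson bij_betw_shift_down bij_betw_trans)
  then have "bij_betw (phi n a) {1..2*n+2} {1..2*n+2}"
    by (subst bij_betw_cong[where g = "Suc \<circ> (a \<circ> shift_down)"])
       (simp_all add: phi_eq[OF assms])
  then have "phi n a permutes {1..2*n+2}"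
    by (rule bij_imp_permutes) (simp only: phi_eq[OF assms] if_False)
  moreover have "phi n a (2*i) < 2*i \<and> phi n a (2*i-1) > 2*i-1" if "i \<in> {1..n+1}" for i
  proof
    show "phi n a (2*i) < 2*i"
    \<comment> \<open>Position 2 reads \<open>a\<close> at 0, outside the range of the D-permutation
      inequalities. For larger i the bound at 2i-2 gives an entry of at most 2i-1.\<close>
    proof (cases "i = 1")
      case True
      then show ?thesis by (simp add: phi_def)
    next
      case False
      have "a (2*i-2) \<le> 2*i-2"
        using that False by (intro D_permutations_even[OF assms]) auto
      then show ?thesis
        using that False by (simp add: phi_eq[OF assms] shift_down_def) linarith
    qed
    \<comment> \<open>At odd positions there is no shift, and adding 1 to the value makes the weak
      inequality strict.\<close>
    have "a (2*i-1) \<ge> 2*i-1"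
      using that by (intro D_permutations_odd[OF assms]) auto
    then show "phi n a (2*i-1) > 2*i-1"
      using that by (auto simp: phi_eq[OF assms] shift_down_def)
  qed
  ultimately show ?thesis
    by (simp add: Dumont_derangements_def)
qed

lemma phi_inv_in_D_permutations:
  assumes "b \<in> Dumont_derangements n"
  shows "phi_inv n b \<in> D_permutations n"
proof -
  have "bij_betw b {1..2*n+2} {1..2*n+2}"
    using Dumont_derangements_permutes[OF assms] by (rule permutes_imp_bij)
  \<comment> \<open>Truncated subtraction is injective here since 0 is not in the domain.\<close>
  moreover have "bij_betw (\<lambda>x. x - 1) {1..2*n+2} {0..2*n+1}"
    by (rule bij_betw_byWitness[where f' = Suc]) auto
  ultimately have "bij_betw ((\<lambda>x. x - 1) \<circ> (b \<circ> shift_up)) {0..2*n+1} {0..2*n+1}"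
    by (meson bij_betw_shift_up bij_betw_trans)
  then have "bij_betw (phi_inv n b) {0..2*n+1} {0..2*n+1}"
    by (subst bij_betw_cong[where g = "(\<lambda>x. x - 1) \<circ> (b \<circ> shift_up)"])
       (simp_all add: phi_inv_def)
  then have "phi_inv n b permutes {0..2*n+1}"
    by (rule bij_imp_permutes) (simp add: phi_inv_def)
  \<comment> \<open>The condition at 2 gives \<open>b 2 < 2\<close>, so subtracting 1 yields 0. This
    fixed point can then be dropped from the permuted set.\<close>
  moreover have "phi_inv n b 0 = 0"
    using Dumont_derangements_even[OF assms, of 2] by (simp add: phi_inv_def shift_up_def numeral_2_eq_2)
  ultimately have "phi_inv n b permutes {1..2*n+1}"
    by (rule_tac permutes_superset[where S = "{0..2*n+1}"]) (auto simp: not_le)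
  \<comment> \<open>The bound \<open>b (i + 2) < i + 2\<close> only gives i+1, and the subtraction
    of 1 brings it down to i.\<close>
  moreover have "phi_inv n b i \<le> i" if "i \<in> {1..2*n+1}" "even i" for i
    using that Dumont_derangements_even[OF assms, of "i + 2"]
    by (auto simp: phi_inv_def shift_up_def elim!: evenE)
  moreover have "phi_inv n b i \<ge> i" if "i \<in> {1..2*n+1}" "odd i" for i
    using that Dumont_derangements_odd[OF assms, of i]
    by (auto simp: phi_inv_def shift_up_def)
  ultimately show ?thesis
    by (simp add: D_permutations_def)
qed

theorem theorem6p2:
  fixes n :: nat
  assumes "n \<ge> 1"
  shows "bij_betw (phi n) (D_permutations n) (Dumont_derangements n)"
proof (rule bij_betw_byWitness[where f' = "phi_inv n"])
  show "\<forall>a\<in>D_permutations n. phi_inv n (phi n a) = a"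
  proof (intro ballI ext)
    fix a k
    assume a: "a \<in> D_permutations n"
    show "phi_inv n (phi n a) k = a k"
      using shift_up_in_iff[of k n] permutes_not_in[OF D_permutations_permutes[OF a], of k]
      by (simp add: phi_inv_def phi_eq[OF a])
  qed
  show "\<forall>b\<in>Dumont_derangements n. phi n (phi_inv n b) = b"
  proof (intro ballI ext)
    fix b j
    assume b: "b \<in> Dumont_derangements n"
    show "phi n (phi_inv n b) j = b j"
      \<comment> \<open>Inside the range, \<open>Suc (b j - 1) = b j\<close> needs
        \<open>b j\<close> to be positive, which holds because \<open>b\<close> maps {1..2n+2} to
        itself.\<close>
      using shift_down_in_iff[of j n] permutes_not_in[OF Dumont_derangements_permutes[OF b], of j]
        permutes_in_image[OF Dumont_derangements_permutes[OF b], of j]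
      by (auto simp: phi_eq[OF phi_inv_in_D_permutations[OF b]] phi_inv_def)
  qed
  show "phi n ` D_permutations n \<subseteq> Dumont_derangements n"
    using phi_in_Dumont_derangements by blast
  show "phi_inv n ` Dumont_derangements n \<subseteq> D_permutations n"
    using phi_inv_in_D_permutations by blast
qed

end
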